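(* For every $n\ge 1$, $\lambda\in\mathbb{R}_+$, $c\in\mathbb{R}$ such that $\psi^{(a)}$ has no points of increase in the interval $(c,c+1)$, and $a>0$, the monic Sobolev-type Charlier polynomials $\{Q_n^\lambda\}_{n\ge0}$ satisfy the five term recurrence relation $$(x-c)(x-c-1)Q_{n}^{\lambda}(x)=Q_{n+2}^{\lambda}(x)+\rho_{n,n+1}Q_{n+1}^{\lambda}(x)+\rho_{n,n}Q_{n}^{\lambda}(x)+\rho_{n,n-1}Q_{n-1}^{\lambda}(x)+\rho_{n,n-2}Q_{n-2}^{\lambda}(x),$$ where $$\rho_{n,n+1}=\frac{\sigma_{n+1,-1}\|C_{n}^{(a)}\|^{2}}{\|Q_{n+1}^{\lambda}\|_{\lambda}^{2}}-\frac{\gamma_{n-1}}{a_{n-2}}(b_{n}-1),$$ $$\rho_{n,n}=\sigma_{n,0}\frac{\|C_{n}^{(a)}\|^{2}}{\|Q_{n}^{\lambda}\|_{\lambda}^{2}}-(b_{n}-1)\left[\frac{\gamma_{n-1}}{a_{n-2}}\left(\sigma_{n,-1}\frac{\|C_{n-1}^{(a)}\|^{2}}{\|Q_{n}^{\lambda}\|_{\lambda}^{2}}-(n+a-c-2)\right)+(a-\gamma_{n})\right],$$ $$\rho_{n,n-1}=\sigma_{n,-1}\frac{\|C_{n-1}^{(a)}\|^{2}}{\|Q_{n-1}^{\lambda}\|_{\lambda}^{2}}-\frac{\gamma_{n-1}}{a_{n-2}}(b_{n}-1)\frac{\|Q_{n}^{\lambda}\|_{\lambda}^{2}}{\|Q_{n-1}^{\lambda}\|_{\lambda}^{2}},$$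 $$\rho_{n,n-2}=\sigma_{n,-2}\frac{\|C_{n-2}^{(a)}\|^{2}}{\|Q_{n-2}^{\lambda}\|_{\lambda}^{2}}.$$
   Context: Let $a>0$ and let $\psi^{(a)}$ be the Poisson distribution, the discrete measure with mass $e^{-a}a^{x}/x!$ at $x=0,1,2,\ldots$. "No points of increase in $(c,c+1)$" means that $(c,c+1)$ contains no nonnegative integer. $\Delta f(x)=f(x+1)-f(x)$. $\{C_n^{(a)}\}_{n\ge0}$ are the monic Charlier polynomials, orthogonal with respect to $\langle p,q\rangle=\int_0^\infty pq\,d\psi^{(a)}$; $C_{-1}^{(a)}=0$, $C_0^{(a)}=1$, $C_{n+1}^{(a)}(x)=(x-n-a)C_n^{(a)}(x)-\gamma_n C_{n-1}^{(a)}(x)$ with $\gamma_n=na$, and $\|C_n^{(a)}\|^2=n!a^n$. $\{Q_n^\lambda\}_{n\ge0}$ is the sequence of monic polynomials ($\deg Q_n^\lambda=n$) orthogonal with respect to $\langle p,q\rangle_\lambda=\int_0^\infty pq\,d\psi^{(a)}+\lambda\,\Delta p(c)\,\Delta q(c)$, and $\|Q_n^\lambda\|_\lambda^2=\langle Q_n^\lambda,Q_n^\lambda\rangle_\lambda$. $K_n^{(1,1)}(c,c)=\sum_{k=0}^n \frac{[\Delta C_k^{(a)}(c)]^2}{\|C_k^{(a)}\|^2}$, and $$a_n=\frac{C_{n+1}^{(a)}(c)}{C_n^{(a)}(c)},\qquad b_n=\frac{1+\lambda K_n^{(1,1)}(c,c)}{1+\lambda K_{n-1}^{(1,1)}(c,c)}.$$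 The numbers $\sigma_{n,j}$ are $$\sigma_{n,0}=a^{2}+(c-n)(n-2a+c+1)+a(n-1)(b_{n}-1)+(n+a-c)\left(2n-a\frac{n-1}{a_{n-2}}(b_{n}-1)\right),$$ $$\sigma_{n,-1}=an(n+a-c-1)(b_{n}+1)+a(b_{n}-1)\left(a_{n-1}-an\frac{n-1}{a_{n-2}}\right),\qquad \sigma_{n,-2}=a^{2}n(n-1)b_{n}.$$
   Formalization: The second term of ρ_{n,n-1} is corrected to (γ_{n-2}/a_{n-3})(b_{n-1}−1)‖Q_n‖²/‖Q_{n-1}‖²; the printed term fails, e.g. a=1, λ=2, c=0, n=2 (printed 188/27, true 44/9). Quotients with zero denominator are read as 0. *)

theory Defs
  imports
    "HOL-Probability.Probability"
    "HOL-Computational_Algebra.Polynomial"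
begin

definition fdiff :: "(real \<Rightarrow> real) \<Rightarrow> real \<Rightarrow> real" where
  "fdiff f x = f (x + 1) - f x"

definition charlier_inner :: "real \<Rightarrow> real poly \<Rightarrow> real poly \<Rightarrow> real" where
  "charlier_inner a p q =
     (LINT x:{0..}|measure_pmf (map_pmf real (poisson_pmf a)). poly p x * poly q x)"

definition sobolev_inner :: "real \<Rightarrow> real \<Rightarrow> real \<Rightarrow> real poly \<Rightarrow> real poly \<Rightarrow> real" where
  "sobolev_inner a lam c p q =
     charlier_inner a p q + lam * fdiff (poly p) c * fdiff (poly q) c"

definition sqnorm :: "(real poly \<Rightarrow> real poly \<Rightarrow> real) \<Rightarrow> real poly \<Rightarrow> real" where
  "sqnorm ip p = ip p p"

text \<open>
  Sequences are indexed by the integers, so that an index such as \<open>n - 2\<close> is an honest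
  subtraction. The values of \<open>P\<close> at negative indices are left unconstrained.
\<close>

definition monic_orthogonal :: "(real poly \<Rightarrow> real poly \<Rightarrow> real) \<Rightarrow> (int \<Rightarrow> real poly) \<Rightarrow> bool" where
  "monic_orthogonal ip P \<longleftrightarrow>
     (\<forall>n\<ge>0. degree (P n) = nat n \<and> lead_coeff (P n) = 1) \<and>
     (\<forall>m\<ge>0. \<forall>n\<ge>0. m \<noteq> n \<longrightarrow> ip (P m) (P n) = 0)"

definition charlier_gamma :: "real \<Rightarrow> int \<Rightarrow> real" where
  "charlier_gamma a n = of_int n * a"

function charlier :: "real \<Rightarrow> int \<Rightarrow> real poly" where
  "charlier a n =
     (if n < 0 then 0
      else if n = 0 then 1
      else [:- of_int (n - 1) - a, 1:] * charlier a (n - 1)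
           - smult (charlier_gamma a (n - 1)) (charlier a (n - 2)))"
  by auto
termination by (relation "Wellfounded.measure (\<lambda>(a, n). nat (n + 1))") auto

declare charlier.simps [simp del]

lemma charlier_neg: "n < 0 \<Longrightarrow> charlier a n = 0"
  by (simp add: charlier.simps)

lemma charlier_0: "charlier a 0 = 1"
  by (simp add: charlier.simps)

lemma charlier_rec:
  "n \<ge> 0 \<Longrightarrow> charlier a (n + 1) =
     [:- of_int n - a, 1:] * charlier a n - smult (charlier_gamma a n) (charlier a (n - 1))"
  by (subst charlier.simps) simp

definition charlier_sqnorm :: "real \<Rightarrow> int \<Rightarrow> real" where
  "charlier_sqnorm a n = sqnorm (charlier_inner a) (charlier a n)"

text \<open>
  The ratio \<open>a\<^sub>n\<close> is used below only as \<open>(b\<^sub>n - 1) * a\<^bsub>n-1\<^esub>\<close> and \<open>(b\<^sub>n - 1) / a\<^bsub>n-2\<^esub>\<close>.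
  Since \<open>b\<^sub>n - 1\<close> is a multiple of the square of \<open>C\<^bsub>n-1\<^esub>(c)\<close>, these are multiples of
  \<open>C\<^bsub>n-1\<^esub>(c) * C\<^sub>n(c)\<close> and \<open>C\<^bsub>n-1\<^esub>(c) * C\<^bsub>n-2\<^esub>(c)\<close>, and \<open>x / 0 = 0\<close> gives them
  the right value when \<open>c\<close> is a zero of one of the polynomials, or when \<open>n = 1\<close>.
\<close>

definition charlier_ratio :: "real \<Rightarrow> real \<Rightarrow> int \<Rightarrow> real" where
  "charlier_ratio a c n = poly (charlier a (n + 1)) c / poly (charlier a n) c"

definition charlier_kernel11 :: "real \<Rightarrow> real \<Rightarrow> int \<Rightarrow> real" where
  "charlier_kernel11 a c n = (\<Sum>k=0..n. (fdiff (poly (charlier a k)) c)\<^sup>2 / charlier_sqnorm a k)"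

definition sobolev_b :: "real \<Rightarrow> real \<Rightarrow> real \<Rightarrow> int \<Rightarrow> real" where
  "sobolev_b a lam c n =
     (1 + lam * charlier_kernel11 a c n) / (1 + lam * charlier_kernel11 a c (n - 1))"

definition sigma0 :: "real \<Rightarrow> real \<Rightarrow> real \<Rightarrow> int \<Rightarrow> real" where
  "sigma0 a lam c n =
     a\<^sup>2 + (c - of_int n) * (of_int n - 2 * a + c + 1)
     + a * (of_int n - 1) * (sobolev_b a lam c n - 1)
     + (of_int n + a - c) *
       (2 * of_int n
        - a * ((of_int n - 1) / charlier_ratio a c (n - 2)) * (sobolev_b a lam c n - 1))"

definition sigma_m1 :: "real \<Rightarrow> real \<Rightarrow> real \<Rightarrow> int \<Rightarrow> real" where
  "sigma_m1 a lam c n =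
     a * of_int n * (of_int n + a - c - 1) * (sobolev_b a lam c n + 1)
     + a * (sobolev_b a lam c n - 1) *
       (charlier_ratio a c (n - 1)
        - a * of_int n * ((of_int n - 1) / charlier_ratio a c (n - 2)))"

definition sigma_m2 :: "real \<Rightarrow> real \<Rightarrow> real \<Rightarrow> int \<Rightarrow> real" where
  "sigma_m2 a lam c n = a\<^sup>2 * of_int n * (of_int n - 1) * sobolev_b a lam c n"

text \<open>In the following four definitions, \<open>Q\<close> is the Sobolev-type sequence.\<close>

definition rho_p1 :: "real \<Rightarrow> real \<Rightarrow> real \<Rightarrow> (int \<Rightarrow> real poly) \<Rightarrow> int \<Rightarrow> real" where
  "rho_p1 a lam c Q n =
     sigma_m1 a lam c (n + 1) * charlier_sqnorm a n / sqnorm (sobolev_inner a lam c) (Q (n + 1))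
     - charlier_gamma a (n - 1) / charlier_ratio a c (n - 2) * (sobolev_b a lam c n - 1)"

definition rho_0 :: "real \<Rightarrow> real \<Rightarrow> real \<Rightarrow> (int \<Rightarrow> real poly) \<Rightarrow> int \<Rightarrow> real" where
  "rho_0 a lam c Q n =
     sigma0 a lam c n * (charlier_sqnorm a n / sqnorm (sobolev_inner a lam c) (Q n))
     - (sobolev_b a lam c n - 1) *
       (charlier_gamma a (n - 1) / charlier_ratio a c (n - 2) *
          (sigma_m1 a lam c n * (charlier_sqnorm a (n - 1) / sqnorm (sobolev_inner a lam c) (Q n))
           - (of_int n + a - c - 2))
        + (a - charlier_gamma a n))"

text \<open>
  Multiplication by \<open>(x - c) * (x - c - 1)\<close> is symmetric for the Sobolev-type product, so the
  coefficient \<open>\<rho>\<^bsub>n,n-1\<^esub>\<close> must be \<open>\<rho>\<^bsub>n-1,n\<^esub> * \<parallel>Q\<^sub>n\<parallel>\<^sup>2 / \<parallel>Q\<^bsub>n-1\<^esub>\<parallel>\<^sup>2\<close>. Its second term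
  therefore carries \<open>\<gamma>\<^bsub>n-2\<^esub>\<close>, \<open>a\<^bsub>n-3\<^esub>\<close>, \<open>b\<^bsub>n-1\<^esub>\<close>. The source prints this term with the
  unshifted \<open>\<gamma>\<^bsub>n-1\<^esub>\<close>, \<open>a\<^bsub>n-2\<^esub>\<close>, \<open>b\<^sub>n\<close>, which makes the recurrence false (for instance for
  \<open>a = 1\<close>, \<open>\<lambda> = 2\<close>, \<open>c = 0\<close>, \<open>n = 2\<close>).
\<close>

definition rho_m1 :: "real \<Rightarrow> real \<Rightarrow> real \<Rightarrow> (int \<Rightarrow> real poly) \<Rightarrow> int \<Rightarrow> real" where
  "rho_m1 a lam c Q n =
     sigma_m1 a lam c n * (charlier_sqnorm a (n - 1) / sqnorm (sobolev_inner a lam c) (Q (n - 1)))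
     - charlier_gamma a (n - 2) / charlier_ratio a c (n - 3) * (sobolev_b a lam c (n - 1) - 1) *
       (sqnorm (sobolev_inner a lam c) (Q n) / sqnorm (sobolev_inner a lam c) (Q (n - 1)))"

definition rho_m2 :: "real \<Rightarrow> real \<Rightarrow> real \<Rightarrow> (int \<Rightarrow> real poly) \<Rightarrow> int \<Rightarrow> real" where
  "rho_m2 a lam c Q n =
     sigma_m2 a lam c n * (charlier_sqnorm a (n - 2) / sqnorm (sobolev_inner a lam c) (Q (n - 2)))"

end

theory Submission
  imports Defs
begin

text \<open>
  Put \<open>W = (x - c) (x - c - 1)\<close>. As \<open>W\<close> vanishes at \<open>c\<close> and \<open>c + 1\<close>, multiplication by \<open>W\<close> is
  symmetric for the Sobolev-type product and \<open>\<langle>W p, q\<rangle>\<^sub>\<lambda> = \<langle>p, W q\<rangle>\<close>; expanding \<open>W Q\<^sub>n\<close> in the \<open>Q\<^sub>k\<close>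
  therefore gives a five term recurrence, whose coefficients below the diagonal are determined by
  those above it. The two remaining coefficients are found by pairing the recurrence with
  \<open>C\<^bsub>n+1\<^esub>\<close> and \<open>C\<^sub>n\<close>, using \<open>\<langle>Q\<^sub>n, C\<^sub>k\<rangle> = - \<lambda> \<Delta>Q\<^sub>n(c) \<Delta>C\<^sub>k(c)\<close> for \<open>k < n\<close>,
  \<open>\<Delta>Q\<^sub>n(c) = \<Delta>C\<^sub>n(c) / (1 + \<lambda> K\<^bsub>n-1\<^esub>)\<close> and \<open>\<Delta>C\<^sub>n = n C\<^bsub>n-1\<^esub>\<close>. With
  \<open>e\<^sub>n = \<lambda> / (\<parallel>C\<^sub>n\<parallel>\<^sup>2 (1 + \<lambda> K\<^bsub>n-1\<^esub>))\<close> one has \<open>b\<^sub>n = 1 + e\<^sub>n n\<^sup>2 C\<^bsub>n-1\<^esub>(c)\<^sup>2\<close>, and after use of the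
  three term recurrence at \<open>c\<close> the claimed formulas are polynomial identities in \<open>e\<^sub>n\<close>,
  \<open>C\<^bsub>n-1\<^esub>(c)\<close>, \<open>C\<^bsub>n-2\<^esub>(c)\<close>, \<open>a\<close>, \<open>c\<close> and \<open>n\<close>.
\<close>

subsection \<open>Polynomial moments of the Poisson distribution\<close>

definition poisson_mean :: "real \<Rightarrow> real poly \<Rightarrow> real" where
  "poisson_mean a p = measure_pmf.expectation (poisson_pmf a) (\<lambda>k. poly p (real k))"

text \<open>A single term of the exponential series gives k^m / m! \<le> e^k, so every moment is
  dominated by a multiple of the series of exp (a e).\<close>

lemma abs_summable_poisson_poly:
  fixes a :: real
  assumes "a > 0"
  shows "summable (\<lambda>k. norm (pmf (poisson_pmf a) k * poly p (real k)))"
proof -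
  have monom: "summable (\<lambda>k. pmf (poisson_pmf a) k * real k ^ m)" for m
  proof (rule summable_comparison_test')
    show "summable (\<lambda>k. exp (-a) * fact m * ((a * exp 1) ^ k /\<^sub>R fact k))"
      by (intro summable_mult summable_exp_generic)
    fix k :: nat
    have "real k ^ m / fact m \<le> exp (real k)"
      using sums_le[OF _ sums_single[of m "\<lambda>_. real k ^ m / fact m"] exp_converges[of "real k"]]
      by (simp add: divide_inverse mult.commute)
    then show "norm (pmf (poisson_pmf a) k * real k ^ m)
        \<le> exp (-a) * fact m * ((a * exp 1) ^ k /\<^sub>R fact k)"
      using assms by (simp add: pmf_poisson power_mult_distrib exp_of_nat_mult[of k 1, simplified] field_simps mult_left_mono)
  qed
  have "summable (\<lambda>k. \<Sum>i\<le>degree p. \<bar>coeff p i\<bar> * (pmf (poisson_pmf a) k * real k ^ i))"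
    by (intro summable_sum summable_mult monom)
  then show ?thesis
  proof (rule summable_comparison_test')
    fix k :: nat
    show "norm (norm (pmf (poisson_pmf a) k * poly p (real k)))
        \<le> (\<Sum>i\<le>degree p. \<bar>coeff p i\<bar> * (pmf (poisson_pmf a) k * real k ^ i))"
      unfolding poly_altdef sum_distrib_left real_norm_def abs_abs
      by (rule order.trans[OF sum_abs]) (simp add: abs_mult mult_ac)
  qed
qed

lemma integrable_poisson_poly:
  "a > 0 \<Longrightarrow> integrable (measure_pmf (poisson_pmf a)) (\<lambda>k. poly p (real k))"
  using abs_summable_poisson_poly[of a p]
  by (simp add: measure_pmf_eq_density integrable_density integrable_count_space_nat_iff)

lemma poisson_mean_sums:
  assumes "a > 0"
  shows "(\<lambda>k. pmf (poisson_pmf a) k * poly p (real k)) sums poisson_mean a p"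
proof -
  have "integrable (count_space UNIV) (\<lambda>k. pmf (poisson_pmf a) k * poly p (real k))"
    using abs_summable_poisson_poly[OF assms, of p] by (simp add: integrable_count_space_nat_iff)
  from sums_integral_count_space_nat[OF this] show ?thesis
    by (simp add: poisson_mean_def measure_pmf_eq_density integral_density)
qed

text \<open>The weights satisfy (k + 1) w(k + 1) = a w(k), and the factor x kills the term at k =
  0.\<close>

lemma poisson_mean_shift:
  assumes "a > 0"
  shows "poisson_mean a ([:0, 1:] * p) = a * poisson_mean a (pcompose p [:1, 1:])"
proof -
  have "(\<lambda>k. pmf (poisson_pmf a) (Suc k) * poly ([:0, 1:] * p) (real (Suc k)))
      = (\<lambda>k. a * (pmf (poisson_pmf a) k * poly (pcompose p [:1, 1:]) (real k)))"
    using assms by (auto simp: pmf_poisson poly_pcompose field_simps fun_eq_iff simp del: of_nat_Suc) (simp_all add: add.commute)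
  then show ?thesis
    using sums_unique2[OF poisson_mean_sums[OF assms, of "[:0, 1:] * p"]]
      sums_Suc[of "\<lambda>k. pmf (poisson_pmf a) k * poly ([:0, 1:] * p) (real k)" "a * poisson_mean a (pcompose p [:1, 1:])"]
      sums_mult[OF poisson_mean_sums[OF assms, of "pcompose p [:1, 1:]"], of a]
    by simp
qed

lemma poisson_mean_add: "a > 0 \<Longrightarrow> poisson_mean a (p + q) = poisson_mean a p + poisson_mean a q"
  by (simp add: poisson_mean_def integrable_poisson_poly)

lemma poisson_mean_smult: "poisson_mean a (smult s p) = s * poisson_mean a p"
  by (simp add: poisson_mean_def)

text \<open>The Poisson law charges every natural number, so a zero mean would give the polynomial
  infinitely many roots.\<close>

lemma poisson_mean_square_pos:
  assumes "a > 0" "p \<noteq> 0"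
  shows "poisson_mean a (p * p) > 0"
proof (rule ccontr)
  let ?M = "measure_pmf (poisson_pmf a)"
  assume "\<not> ?thesis"
  moreover have "poisson_mean a (p * p) \<ge> 0"
    by (simp add: poisson_mean_def)
  ultimately have "poisson_mean a (p * p) = 0"
    by linarith
  then have "integral\<^sup>L ?M (\<lambda>k. poly (p * p) (real k)) = 0"
    by (simp only: poisson_mean_def)
  then have "AE k in ?M. poly (p * p) (real k) = 0"
    by (subst (asm) integral_nonneg_eq_0_iff_AE) (auto simp: integrable_poisson_poly assms(1) simp del: poly_mult, simp)
  then have "range real \<subseteq> {x. poly p x = 0}"
    using assms(1) by (auto simp: AE_measure_pmf_iff set_pmf_poisson)
  moreover have "infinite (range real)"
    by (simp add: finite_image_iff inj_on_def)
  ultimately show False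
    using poly_roots_finite[OF assms(2)] finite_subset by blast
qed

lemma charlier_inner_eq: "charlier_inner a p q = poisson_mean a (p * q)"
  by (simp add: charlier_inner_def poisson_mean_def set_lebesgue_integral_def)

subsection \<open>Orthogonal sequences of polynomials\<close>

text \<open>Collects what the Charlier and the Sobolev-type products share, so that monic orthogonal
  sequences are treated once for both.\<close>

locale poly_inner =
  fixes ip :: "real poly \<Rightarrow> real poly \<Rightarrow> real"
  assumes add_left: "ip (p + q) r = ip p r + ip q r"
    and smult_left: "ip (smult s p) r = s * ip p r"
    and sym: "ip p q = ip q p"
    and pos: "p \<noteq> 0 \<Longrightarrow> ip p p > 0"
begin

lemma add_right: "ip r (p + q) = ip r p + ip r q"
  by (metis add_left sym)

lemma smult_right: "ip r (smult s p) = s * ip r p"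
  by (metis smult_left sym)

lemma zero_left: "ip 0 r = 0"
  using smult_left[of 0 0 r] by simp

lemma zero_right: "ip r 0 = 0"
  by (metis zero_left sym)

lemma diff_left: "ip (p - q) r = ip p r - ip q r"
  using add_left[of "p - q" q r] by simp

lemma diff_right: "ip r (p - q) = ip r p - ip r q"
  by (metis diff_left sym)

lemma sum_left: "ip (sum f A) r = (\<Sum>k\<in>A. ip (f k) r)"
  by (induction A rule: infinite_finite_induct) (auto simp: zero_left add_left)

lemmas bilinear = add_left add_right smult_left smult_right diff_left diff_right zero_left zero_right

context
  fixes P :: "int \<Rightarrow> real poly"
  assumes orth: "monic_orthogonal ip P"
begin

lemma degree_seq: "n \<ge> 0 \<Longrightarrow> degree (P n) = nat n"
  and coeff_seq: "n \<ge> 0 \<Longrightarrow> coeff (P n) (nat n) = 1"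
  and ip_seq: "m \<ge> 0 \<Longrightarrow> n \<ge> 0 \<Longrightarrow> m \<noteq> n \<Longrightarrow> ip (P m) (P n) = 0"
  using orth unfolding monic_orthogonal_def by metis+

lemma sqnorm_seq_pos: "n \<ge> 0 \<Longrightarrow> sqnorm ip (P n) > 0"
  unfolding sqnorm_def using coeff_seq[of n] by (intro pos) auto

text \<open>One elimination step. The alternative \<open>= 0\<close> covers \<open>m = 0\<close>,
  since the zero polynomial has degree 0.\<close>

lemma reduce_degree:
  assumes "degree p \<le> m"
  shows "p - smult (coeff p m) (P (int m)) = 0 \<or> degree (p - smult (coeff p m) (P (int m))) < m"
proof -
  let ?r = "p - smult (coeff p m) (P (int m))"
  have "degree ?r \<le> m"
    using assms degree_seq[of "int m"] by (intro degree_diff_le) (auto intro: order.trans[OF degree_smult_le])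
  moreover have "coeff ?r m = 0"
    using coeff_seq[of "int m"] by simp
  ultimately show ?thesis
    by (metis le_neq_implies_less leading_coeff_0_iff)
qed

text \<open>Induction on a degree bound: \<open>reduce_degree\<close> strips the leading term, and
  the removed multiple of \<open>P (int m)\<close> is orthogonal to \<open>P n\<close>.\<close>

lemma ip_lower_degree:
  assumes "n \<ge> 0" "degree p < nat n"
  shows "ip p (P n) = 0"
proof -
  have "ip p (P n) = 0" if "degree p < m" "m \<le> nat n" for m p
    using that
  proof (induction m arbitrary: p)
    case (Suc m)
    let ?r = "p - smult (coeff p m) (P (int m))"
    have "ip ?r (P n) = 0"
      using reduce_degree[of p m] Suc by (auto simp: zero_left)
    moreover have "ip (P (int m)) (P n) = 0"
      using Suc.prems by (intro ip_seq) auto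
    ultimately show ?case
      by (simp add: diff_left smult_left)
  qed simp
  then show ?thesis
    using assms by blast
qed

lemma ip_monic:
  assumes "n \<ge> 0" "degree p = nat n" "coeff p (nat n) = 1"
  shows "ip p (P n) = sqnorm ip (P n)"
proof -
  have "ip (p - P n) (P n) = 0"
    using reduce_degree[of p "nat n"] assms ip_lower_degree by (auto simp: zero_left)
  then show ?thesis
    by (simp add: diff_left sqnorm_def)
qed

text \<open>Otherwise \<open>p\<close>, made monic, would pair with the member of its own degree to
  a positive squared norm.\<close>

lemma orthogonal_eq_0:
  assumes "degree p \<le> m" "\<And>k. 0 \<le> k \<Longrightarrow> k \<le> int m \<Longrightarrow> ip p (P k) = 0"
  shows "p = 0"
proof (rule ccontr)
  assume "p \<noteq> 0"
  let ?d = "degree p" and ?q = "smult (inverse (lead_coeff p)) p"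
  have "ip ?q (P (int ?d)) = sqnorm ip (P (int ?d))"
    using \<open>p \<noteq> 0\<close> by (intro ip_monic) auto
  then show False
    using assms sqnorm_seq_pos[of "int ?d"] by (simp add: smult_left)
qed

text \<open>The difference of the two sides is orthogonal to all members of index at most m, hence
  zero.\<close>

lemma expansion:
  assumes "degree p \<le> m"
  shows "p = (\<Sum>k=0..int m. smult (ip p (P k) / sqnorm ip (P k)) (P k))" (is "_ = ?s")
proof -
  have "p - ?s = 0"
  proof (rule orthogonal_eq_0[where m = m])
    show "degree (p - ?s) \<le> m"
      using assms by (intro degree_diff_le degree_sum_le) (auto simp: degree_seq intro: order.trans[OF degree_smult_le])
    fix k :: int assume k: "0 \<le> k" "k \<le> int m"
    have "ip ?s (P k) = (\<Sum>j=0..int m. if j = k then ip p (P k) else 0)"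
      unfolding sum_left using k sqnorm_seq_pos[of k]
      by (intro sum.cong) (auto simp: smult_left ip_seq, simp add: sqnorm_def)
    then show "ip (p - ?s) (P k) = 0"
      using k by (simp add: diff_left)
  qed
  then show ?thesis by simp
qed

end

end

subsection \<open>Charlier polynomials\<close>

lemma poly_inner_charlier:
  assumes "a > 0"
  shows "poly_inner (charlier_inner a)"
  by standard (auto simp: charlier_inner_eq poisson_mean_add[OF assms] poisson_mean_smult
      poisson_mean_square_pos[OF assms] distrib_left mult.commute)

lemma poly_inner_sobolev:
  assumes "a > 0" "lam \<ge> 0"
  shows "poly_inner (sobolev_inner a lam c)"
proof -
  interpret C: poly_inner "charlier_inner a"
    by (rule poly_inner_charlier) fact
  show ?thesis
  proof
    fix p :: "real poly" assume "p \<noteq> 0"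
    from C.pos[OF this] show "sobolev_inner a lam c p p > 0"
      using assms by (auto simp: sobolev_inner_def mult.assoc intro: add_pos_nonneg)
  qed (auto simp: sobolev_inner_def fdiff_def C.bilinear algebra_simps intro: C.sym)
qed

text \<open>The three term recurrence reaches back two indices, so the step is given all earlier
  cases.\<close>

lemma charlier_induct [consumes 1, case_names 0 Suc]:
  fixes n :: int
  assumes "n \<ge> 0" "P 0" "\<And>n. n \<ge> 0 \<Longrightarrow> (\<And>k. 0 \<le> k \<Longrightarrow> k \<le> n \<Longrightarrow> P k) \<Longrightarrow> P (n + 1)"
  shows "P n"
proof -
  have "\<forall>k. 0 \<le> k \<longrightarrow> k \<le> n \<longrightarrow> P k"
    using assms(1)
  proof (induction n rule: int_ge_induct)
    case base
    then show ?case using assms(2) by (metis order.antisym)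
  next
    case (step i)
    then show ?case using assms(3)[of i] by (metis zle_add1_eq_le order_le_less)
  qed
  then show ?thesis using assms(1) by blast
qed

lemma degree_coeff_charlier:
  assumes "n \<ge> 0"
  shows "degree (charlier a n) = nat n \<and> coeff (charlier a n) (nat n) = 1"
  using assms
proof (induction rule: charlier_induct)
  case 0
  then show ?case by (simp add: charlier_0)
next
  case (Suc n)
  let ?q = "[:- of_int n - a, 1:] * charlier a n"
    and ?r = "smult (charlier_gamma a n) (charlier a (n - 1))"
  have n: "degree (charlier a n) = nat n" "coeff (charlier a n) (nat n) = 1"
    using Suc by auto
  then have nz: "charlier a n \<noteq> 0"
    by auto
  have q: "degree ?q = nat (n + 1)"
    using n nz Suc(1) by (subst degree_mult_eq) (auto simp: nat_add_distrib)
  have qc: "coeff ?q (nat (n + 1)) = 1"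
    using lead_coeff_mult[of "[:- of_int n - a, 1:]" "charlier a n"] n q by simp
  have r: "degree ?r < nat (n + 1)"
  \<comment> \<open>The induction hypothesis says nothing about index -1, where the polynomial is
    zero by convention.\<close>
  proof (cases "n = 0")
    case True
    then show ?thesis by (simp add: charlier_neg)
  next
    case False
    with Suc(1) have "degree (charlier a (n - 1)) = nat (n - 1)"
      by (intro Suc(2)[THEN conjunct1]) auto
    then show ?thesis
      using False Suc(1) degree_smult_le[of "charlier_gamma a n" "charlier a (n - 1)"] by auto
  qed
  have "degree (?q - ?r) = nat (n + 1)"
    using degree_add_eq_left[of "- ?r" ?q] q r
    by (simp only: diff_conv_add_uminus degree_minus)
  moreover have "coeff (?q - ?r) (nat (n + 1)) = 1"
    by (simp only: coeff_diff qc coeff_eq_0[OF r] diff_zero)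
  ultimately show ?case
    unfolding charlier_rec[OF Suc(1)] by blast
qed

lemma poly_charlier_rec:
  "n \<ge> 0 \<Longrightarrow> poly (charlier a (n + 1)) x =
     (x - of_int n - a) * poly (charlier a n) x - of_int n * a * poly (charlier a (n - 1)) x"
  unfolding charlier_rec by (simp add: charlier_gamma_def algebra_simps)

lemma poly_charlier_shift:
  assumes "n \<ge> 0"
  shows "poly (charlier a n) (x + 1) = poly (charlier a n) x + of_int n * poly (charlier a (n - 1)) x"
  using assms
proof (induction rule: charlier_induct)
  case 0
  then show ?case by (simp add: charlier_0 charlier_neg)
next
  case (Suc n)
  have IH: "poly (charlier a n) (x + 1) = poly (charlier a n) x + of_int n * poly (charlier a (n - 1)) x"
    using Suc by auto
  show ?case
  proof (cases "n = 0")
    case True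
    then show ?thesis
      using poly_charlier_rec[of 0 a] by (simp add: charlier_0 charlier_neg)
  next
    case False
    then have IH': "poly (charlier a (n - 1)) (x + 1)
        = poly (charlier a (n - 1)) x + (of_int n - 1) * poly (charlier a (n - 2)) x"
      using Suc(1) Suc(2)[of "n - 1"] by simp
    have rec: "poly (charlier a n) x = (x - of_int n + 1 - a) * poly (charlier a (n - 1)) x
        - (of_int n - 1) * a * poly (charlier a (n - 2)) x"
      using poly_charlier_rec[of "n - 1" a x] False Suc(1) by (simp add: algebra_simps)
    \<comment> \<open>After both induction hypotheses are substituted, what remains to be shown is n
      times the recurrence for C_n.\<close>
    have "of_int n * ((x - of_int n + 1 - a) * poly (charlier a (n - 1)) x
        - (of_int n - 1) * a * poly (charlier a (n - 2)) x) = of_int n * poly (charlier a n) x"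
      using rec by simp
    then show ?thesis
      unfolding poly_charlier_rec[OF Suc(1)] IH IH' by (simp add: algebra_simps)
  qed
qed

section \<open>The difference operator and orthogonality of the Charlier polynomials\<close>

definition poly_diff :: "real poly \<Rightarrow> real poly" where
  "poly_diff p = pcompose p [:1, 1:] - p"

lemma poly_diff_charlier:
  "n \<ge> 0 \<Longrightarrow> poly_diff (charlier a n) = smult (of_int n) (charlier a (n - 1))"
  by (subst poly_eq_poly_eq_iff[symmetric])
    (auto simp: fun_eq_iff poly_diff_def poly_pcompose poly_charlier_shift add.commute[of 1])

text \<open>Summation by parts against the Poisson weight.\<close>

lemma charlier_inner_raise:
  assumes "a > 0" "n \<ge> 0"
  shows "charlier_inner a (charlier a (n + 1)) p = a * charlier_inner a (charlier a n) (poly_diff p)"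
  using assms(2)
proof (induction arbitrary: p rule: charlier_induct)
  interpret poly_inner "charlier_inner a"
    by (rule poly_inner_charlier) fact
  have shift: "charlier_inner a ([:0, 1:] * q) p
      = a * charlier_inner a (pcompose q [:1, 1:]) (p + poly_diff p)" for p q
    using poisson_mean_shift[OF assms(1), of "q * p"]
    by (simp add: charlier_inner_eq poly_diff_def pcompose_mult mult.assoc del: mult_pCons_left)
  \<comment> \<open>The last bracket is the defect of the claim at index n - 1: it vanishes by
    induction, and for n = 0 its coefficient does.\<close>
  have rec: "charlier_inner a (charlier a (n + 1)) p = a * charlier_inner a (charlier a n) (poly_diff p)
     + of_int n * (a * charlier_inner a (charlier a (n - 1)) (poly_diff p)
         - charlier_inner a (charlier a n) p)" if "n \<ge> 0" for n p
  proof -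
    have 1: "[:- of_int n - a, 1:] * charlier a n = [:0, 1:] * charlier a n - smult (of_int n + a) (charlier a n)"
      by (simp add: smult_add_left[symmetric] smult_minus_left[symmetric] del: smult_minus_left)
    have 2: "pcompose (charlier a n) [:1, 1:] = charlier a n + smult (of_int n) (charlier a (n - 1))"
      using poly_diff_charlier[OF that, of a] by (simp add: poly_diff_def algebra_simps)
    show ?thesis
      unfolding charlier_rec[OF that] 1 bilinear shift 2 charlier_gamma_def by (simp add: algebra_simps)
  qed
  case 0
  show ?case using rec[of 0] by simp
  case (Suc n)
  show ?case
    using rec[of "n + 1" p] Suc(1) Suc(2)[of n p] by simp
qed

text \<open>Summation by parts turns the second factor into m C_{m-1}, so both indices drop at once;
  at \<open>m = 0\<close> the factor m gives zero.\<close>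

lemma charlier_inner_Suc:
  assumes "a > 0" "n \<ge> 0" "m \<ge> 0"
  shows "charlier_inner a (charlier a (n + 1)) (charlier a m)
    = a * of_int m * charlier_inner a (charlier a n) (charlier a (m - 1))"
proof -
  interpret poly_inner "charlier_inner a"
    by (rule poly_inner_charlier) fact
  show ?thesis
    using assms by (simp add: charlier_inner_raise poly_diff_charlier bilinear)
qed

lemma charlier_sqnorm_Suc:
  "a > 0 \<Longrightarrow> n \<ge> 0 \<Longrightarrow> charlier_sqnorm a (n + 1) = a * of_int (n + 1) * charlier_sqnorm a n"
  by (simp add: charlier_sqnorm_def sqnorm_def charlier_inner_Suc)

text \<open>Lowering both indices repeatedly brings the smaller one to 0, where the product
  vanishes.\<close>

lemma monic_orthogonal_charlier:
  assumes "a > 0"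
  shows "monic_orthogonal (charlier_inner a) (charlier a)"
proof -
  interpret poly_inner "charlier_inner a"
    by (rule poly_inner_charlier) fact
  have "charlier_inner a (charlier a n) (charlier a m) = 0" if "n \<ge> 0" "m \<ge> 0" "m < n" for m n
    using that
  proof (induction arbitrary: m rule: charlier_induct)
    case (Suc n)
    then show ?case
      using assms by (cases "m = 0") (auto simp: charlier_inner_Suc)
  qed simp
  then show ?thesis
    unfolding monic_orthogonal_def using degree_coeff_charlier
    by (metis linorder_neqE sym)
qed

text \<open>Two applications of the recurrence, written for multiplication by x - c.\<close>

lemma charlier_mult_quadratic:
  assumes "n \<ge> 0"
  shows "[:- c, 1:] * ([:- c - 1, 1:] * charlier a n) =
    charlier a (n + 2) + smult (2 * (of_int n + a - c)) (charlier a (n + 1))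
    + smult (charlier_gamma a (n + 1) + (of_int n + a - c)\<^sup>2 + charlier_gamma a n - (of_int n + a - c)) (charlier a n)
    + smult (2 * charlier_gamma a n * (of_int n + a - c - 1)) (charlier a (n - 1))
    + smult (charlier_gamma a n * charlier_gamma a (n - 1)) (charlier a (n - 2))"
proof (subst poly_eq_poly_eq_iff[symmetric], rule ext)
  fix x
  let ?y = "\<lambda>k. poly (charlier a k) x" and ?b = "of_int n + a - c" and ?g = "charlier_gamma a"
  have 1: "(x - c) * ?y n = ?y (n + 1) + ?b * ?y n + ?g n * ?y (n - 1)"
    using poly_charlier_rec[of n a x] assms by (simp add: charlier_gamma_def algebra_simps)
  have 2: "(x - c) * ?y (n + 1) = ?y (n + 2) + (?b + 1) * ?y (n + 1) + ?g (n + 1) * ?y n"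
    using poly_charlier_rec[of "n + 1" a x] assms by (simp add: charlier_gamma_def algebra_simps)
  have 3: "?g n * ((x - c) * ?y (n - 1)) = ?g n * (?y n + (?b - 1) * ?y (n - 1) + ?g (n - 1) * ?y (n - 2))"
    using poly_charlier_rec[of "n - 1" a x] assms
    by (cases "n = 0") (simp_all add: charlier_gamma_def algebra_simps)
  have "(x - c) * ((x - c - 1) * ?y n)
      = (x - c) * ((x - c) * ?y n) - (x - c) * ?y n"
    by (simp add: algebra_simps)
  also have "\<dots> = (x - c) * ?y (n + 1) + ?b * ((x - c) * ?y n) + ?g n * ((x - c) * ?y (n - 1)) - (x - c) * ?y n"
    by (subst 1) (simp add: algebra_simps)
  also have "\<dots> = ?y (n + 2) + 2 * ?b * ?y (n + 1) + (?g (n + 1) + ?b\<^sup>2 + ?g n - ?b) * ?y n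
      + 2 * ?g n * (?b - 1) * ?y (n - 1) + ?g n * ?g (n - 1) * ?y (n - 2)"
    unfolding 1 2 3 by (simp add: algebra_simps power2_eq_square)
  finally show "poly ([:- c, 1:] * ([:- c - 1, 1:] * charlier a n)) x = poly (charlier a (n + 2)
    + smult (2 * ?b) (charlier a (n + 1))
    + smult (?g (n + 1) + ?b\<^sup>2 + ?g n - ?b) (charlier a n)
    + smult (2 * ?g n * (?b - 1)) (charlier a (n - 1))
    + smult (?g n * ?g (n - 1)) (charlier a (n - 2))) x"
    by simp (simp add: algebra_simps)
qed

subsection \<open>The Sobolev-type polynomials\<close>

locale charlier_sobolev =
  fixes a lam c :: real and Q :: "int \<Rightarrow> real poly"
  assumes a: "a > 0" and lam: "lam \<ge> 0"
    and Q: "monic_orthogonal (sobolev_inner a lam c) Q"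
begin

sublocale I: poly_inner "charlier_inner a"
  by (rule poly_inner_charlier) (rule a)

sublocale S: poly_inner "sobolev_inner a lam c"
  by (rule poly_inner_sobolev) (rule a lam)+

lemmas charlier_orth = monic_orthogonal_charlier[OF a]

abbreviation y :: "int \<Rightarrow> real" where "y k \<equiv> poly (charlier a k) c"
abbreviation h :: "int \<Rightarrow> real" where "h \<equiv> charlier_sqnorm a"
abbreviation N :: "int \<Rightarrow> real" where "N k \<equiv> sqnorm (sobolev_inner a lam c) (Q k)"
abbreviation diff :: "real poly \<Rightarrow> real" where "diff p \<equiv> fdiff (poly p) c"
abbreviation b :: "int \<Rightarrow> real" where "b \<equiv> sobolev_b a lam c"

definition u :: "int \<Rightarrow> real" where "u n = 1 + lam * charlier_kernel11 a c n"

lemma h_pos: "n \<ge> 0 \<Longrightarrow> h n > 0"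
  using I.sqnorm_seq_pos[OF charlier_orth] by (simp add: charlier_sqnorm_def)

lemma h_Suc: "n \<ge> 0 \<Longrightarrow> h (n + 1) = a * of_int (n + 1) * h n"
  using a by (rule charlier_sqnorm_Suc)

lemma diff_charlier: "diff (charlier a n) = of_int n * y (n - 1)"
  by (cases "n \<ge> 0") (simp_all add: fdiff_def poly_charlier_shift charlier_neg)

lemma u_pos: "u n > 0"
proof -
  have "charlier_kernel11 a c n \<ge> 0"
    unfolding charlier_kernel11_def by (intro sum_nonneg) (auto intro!: divide_nonneg_pos h_pos)
  then show ?thesis
    using lam by (simp add: u_def add_pos_nonneg)
qed

lemma u_step: "n \<ge> 0 \<Longrightarrow> u n = u (n - 1) + lam * (of_int n * y (n - 1))\<^sup>2 / h n"
proof -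
  assume "n \<ge> 0"
  then have "{0..n} = insert n {0..n - 1}" by auto
  then show ?thesis
    by (simp add: u_def charlier_kernel11_def diff_charlier algebra_simps)
qed

lemma b_eq: "b n = u n / u (n - 1)"
  by (simp add: sobolev_b_def u_def)

lemma b_pos: "b n > 0"
  by (simp add: b_eq u_pos)

lemma sobolev_inner_eq: "sobolev_inner a lam c p q = charlier_inner a p q + lam * diff p * diff q"
  by (simp add: sobolev_inner_def)

section \<open>Charlier coefficients, differences at c and norms of the Sobolev-type
  polynomials\<close>

lemma Q_charlier_upper:
  assumes "0 \<le> n" "n < k"
  shows "charlier_inner a (Q n) (charlier a k) = 0"
  using assms S.degree_seq[OF Q] I.ip_lower_degree[OF charlier_orth, of k "Q n"] by simp

lemma Q_charlier_diag:
  assumes "0 \<le> n"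
  shows "charlier_inner a (Q n) (charlier a n) = h n"
  using assms S.degree_seq[OF Q] S.coeff_seq[OF Q] I.ip_monic[OF charlier_orth, of n "Q n"]
  by (simp add: charlier_sqnorm_def)

text \<open>Sobolev orthogonality of Q_n to lower degrees leaves only the discrete term. For
  negative k both sides are 0, which spares later boundary cases.\<close>

lemma Q_charlier_lower:
  assumes "0 \<le> n" "k < n"
  shows "charlier_inner a (Q n) (charlier a k) = - lam * diff (Q n) * of_int k * y (k - 1)"
proof (cases "k \<ge> 0")
  case True
  then have "sobolev_inner a lam c (charlier a k) (Q n) = 0"
    using assms degree_coeff_charlier[of k a] by (intro S.ip_lower_degree[OF Q]) auto
  then show ?thesis
    by (simp add: sobolev_inner_eq diff_charlier I.sym[of "Q n"] eq_neg_iff_add_eq_0 mult_ac)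
qed (simp add: charlier_neg I.bilinear)

text \<open>Expanding Q_n in the C_k with the coefficients of \<open>Q_charlier_lower\<close> and
  taking the difference at c gives a linear equation for Delta Q_n(c), in which the sum becomes the
  kernel.\<close>

lemma diff_Q:
  assumes "0 \<le> n"
  shows "diff (Q n) * u (n - 1) = of_int n * y (n - 1)"
proof -
  have exp: "poly (Q n) z = poly (charlier a n) z
      - lam * diff (Q n) * (\<Sum>k=0..n-1. diff (charlier a k) / h k * poly (charlier a k) z)" for z
  proof -
    have ivl: "{0..int (nat n)} = insert n {0..n - 1}"
      using assms by auto
    have "degree (Q n) \<le> nat n"
      using S.degree_seq[OF Q] assms by simp
    from arg_cong[OF I.expansion[OF charlier_orth this], of "\<lambda>p. poly p z"]
    have "poly (Q n) z = (\<Sum>k\<in>insert n {0..n - 1}. charlier_inner a (Q n) (charlier a k) / h k * poly (charlier a k) z)"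
      by (simp only: poly_sum poly_smult ivl charlier_sqnorm_def)
    also have "\<dots> = charlier_inner a (Q n) (charlier a n) / h n * poly (charlier a n) z
        + (\<Sum>k=0..n-1. charlier_inner a (Q n) (charlier a k) / h k * poly (charlier a k) z)"
      by simp
    also have "(\<Sum>k=0..n-1. charlier_inner a (Q n) (charlier a k) / h k * poly (charlier a k) z)
        = - lam * diff (Q n) * (\<Sum>k=0..n-1. diff (charlier a k) / h k * poly (charlier a k) z)"
      unfolding sum_distrib_left
      by (intro sum.cong) (auto simp: Q_charlier_lower assms diff_charlier)
    finally show ?thesis
      using h_pos[OF assms] by (simp add: Q_charlier_diag assms)
  qed
  \<comment> \<open>Keeping \<open>s\<close> abstract stops \<open>diff (Q n)\<close>, which the
    expansion contains on its right, from being unfolded and expanded again.\<close>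
  have gen: "diff (Q n) = diff (charlier a n) - s * (G (c + 1) - G c)"
    if "\<And>z. poly (Q n) z = poly (charlier a n) z - s * G z" for s G
    by (simp add: fdiff_def that algebra_simps)
  have "diff (Q n) = diff (charlier a n) - lam * diff (Q n)
      * ((\<Sum>k=0..n-1. diff (charlier a k) / h k * poly (charlier a k) (c + 1))
        - (\<Sum>k=0..n-1. diff (charlier a k) / h k * poly (charlier a k) c))"
    by (rule gen[where G = "\<lambda>z. \<Sum>k=0..n-1. diff (charlier a k) / h k * poly (charlier a k) z", OF exp])
  also have "(\<Sum>k=0..n-1. diff (charlier a k) / h k * poly (charlier a k) (c + 1))
        - (\<Sum>k=0..n-1. diff (charlier a k) / h k * poly (charlier a k) c) = charlier_kernel11 a c (n - 1)"
    unfolding charlier_kernel11_def sum_subtractf[symmetric]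
    by (intro sum.cong) (simp_all add: fdiff_def power2_eq_square algebra_simps diff_divide_distrib add_divide_distrib)
  finally show ?thesis
    by (simp add: u_def diff_charlier algebra_simps)
qed

text \<open>Q_n may be paired with C_n instead of itself, as both are monic of degree n.\<close>

lemma N_eq:
  assumes "0 \<le> n"
  shows "N n = h n * b n"
proof -
  have "N n = sobolev_inner a lam c (charlier a n) (Q n)"
    using degree_coeff_charlier[OF assms] assms by (intro S.ip_monic[OF Q, symmetric]) auto
  also have "\<dots> = h n + lam * diff (Q n) * (of_int n * y (n - 1))"
    by (simp add: sobolev_inner_eq I.sym[of "charlier a n"] Q_charlier_diag assms diff_charlier)
  also have "diff (Q n) = of_int n * y (n - 1) / u (n - 1)"
    using diff_Q[OF assms] u_pos[of "n - 1"] by (simp add: field_simps)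
  finally show ?thesis
    using u_pos[of "n - 1"] h_pos[OF assms] u_step[OF assms]
    by (simp add: b_eq field_simps power2_eq_square)
qed

section \<open>The five term recurrence and the relations between its coefficients\<close>

definition W :: "real poly" where "W = [:- c, 1:] * [:- c - 1, 1:]"

lemma diff_W: "diff (W * p) = 0"
  by (simp add: W_def fdiff_def algebra_simps)

lemma sobolev_W: "sobolev_inner a lam c (W * p) q = charlier_inner a p (W * q)"
  by (simp only: sobolev_inner_eq diff_W) (simp add: charlier_inner_eq mult_ac)

lemma sobolev_W_sym: "sobolev_inner a lam c (W * p) q = sobolev_inner a lam c (W * q) p"
  unfolding sobolev_W by (simp add: charlier_inner_eq mult_ac)

lemma degree_W: "degree W = 2" and coeff_W: "coeff W 2 = 1"
  by (simp_all add: W_def numeral_2_eq_2)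

lemma degree_coeff_W_Q:
  assumes "0 \<le> k"
  shows "degree (W * Q k) = nat (k + 2) \<and> coeff (W * Q k) (nat (k + 2)) = 1"
proof -
  have "W \<noteq> 0" "Q k \<noteq> 0"
    using coeff_W S.coeff_seq[OF Q assms] by auto
  then have "degree (W * Q k) = nat (k + 2)"
    using assms S.degree_seq[OF Q assms] by (simp add: degree_mult_eq degree_W)
  then show ?thesis
    using lead_coeff_mult[of W "Q k"] assms S.degree_seq[OF Q assms] S.coeff_seq[OF Q assms]
    by (simp add: degree_W coeff_W)
qed

text \<open>The coefficients of W Q_n in the Q_k. They are set to 0 for negative k, where
  \<open>Q k\<close> is unconstrained, so that the recurrence needs no special form for small
  n.\<close>

definition r :: "int \<Rightarrow> int \<Rightarrow> real" where
  "r n k = (if k < 0 then 0 else sobolev_inner a lam c (W * Q n) (Q k) / N k)"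

text \<open>For large k by degree; for small k by moving W to the other factor and comparing degrees
  again.\<close>

lemma sobolev_W_eq_0: "0 \<le> n \<Longrightarrow> 0 \<le> k \<Longrightarrow> k > n + 2 \<or> k < n - 2 \<Longrightarrow> sobolev_inner a lam c (W * Q n) (Q k) = 0"
  using degree_coeff_W_Q[of n] degree_coeff_W_Q[of k] S.ip_lower_degree[OF Q, of k "W * Q n"] S.ip_lower_degree[OF Q, of n "W * Q k"]
    sobolev_W_sym[of "Q n" "Q k"] by auto

lemma N_pos: "0 \<le> n \<Longrightarrow> N n > 0"
  by (simp add: N_eq h_pos b_pos)

lemma r_top: "0 \<le> n \<Longrightarrow> r n (n + 2) = 1"
  using degree_coeff_W_Q[of n] S.ip_monic[OF Q, of "n + 2" "W * Q n"] N_pos[of "n + 2"] by (simp add: r_def)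

lemma r_swap: "0 \<le> n \<Longrightarrow> 0 \<le> k \<Longrightarrow> r n k * N k = r k n * N n"
  using N_pos[of n] N_pos[of k] sobolev_W_sym[of "Q n" "Q k"] by (simp add: r_def)

lemma five_term:
  assumes "0 \<le> n"
  shows "W * Q n = Q (n + 2) + smult (r n (n + 1)) (Q (n + 1)) + smult (r n n) (Q n)
    + smult (r n (n - 1)) (Q (n - 1)) + smult (r n (n - 2)) (Q (n - 2))"
proof -
  have "W * Q n = (\<Sum>k=0..int (nat (n + 2)). smult (sobolev_inner a lam c (W * Q n) (Q k) / N k) (Q k))"
    using degree_coeff_W_Q[OF assms] by (intro S.expansion[OF Q]) simp
  also have "\<dots> = (\<Sum>k=0..int (nat (n + 2)). smult (r n k) (Q k))"
    by (intro sum.cong) (auto simp: r_def)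
  \<comment> \<open>For n < 2 this set contains negative indices; there \<open>r n k\<close> is
    0.\<close>
  also have "\<dots> = (\<Sum>k\<in>{n - 2, n - 1, n, n + 1, n + 2}. smult (r n k) (Q k))"
    using assms sobolev_W_eq_0[OF assms] by (intro sum.mono_neutral_cong) (auto simp: r_def)
  finally show ?thesis
    using r_top[OF assms] by (simp add: add_ac)
qed

lemma W_charlier:
  "n \<ge> 0 \<Longrightarrow> W * charlier a n =
    charlier a (n + 2) + smult (2 * (of_int n + a - c)) (charlier a (n + 1))
    + smult (charlier_gamma a (n + 1) + (of_int n + a - c)\<^sup>2 + charlier_gamma a n - (of_int n + a - c)) (charlier a n)
    + smult (2 * charlier_gamma a n * (of_int n + a - c - 1)) (charlier a (n - 1))
    + smult (charlier_gamma a n * charlier_gamma a (n - 1)) (charlier a (n - 2))"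
  unfolding W_def mult.assoc[of "[:- c, 1:]"] by (rule charlier_mult_quadratic)

lemma charlier_inner_W: "charlier_inner a (W * p) q = charlier_inner a p (W * q)"
  by (simp add: charlier_inner_eq mult_ac)

text \<open>The factor \<open>r n k\<close> covers negative k, where nothing is known about the
  degree of \<open>Q k\<close>.\<close>

lemma lower_coeff_0: "0 \<le> n \<Longrightarrow> k < j \<Longrightarrow> 0 \<le> j \<Longrightarrow> r n k * charlier_inner a (Q k) (charlier a j) = 0"
  by (cases "k < 0") (simp_all add: r_def Q_charlier_upper)

text \<open>Pairing the recurrence with C_{n+1} kills every Q_k with k \<le> n; on the other side W
  is moved onto C_{n+1}, and only its C_n and C_{n-1} terms survive.\<close>

lemma r_up_raw:
  assumes "0 \<le> n"
  shows "r n (n + 1) * h (n + 1) - lam * diff (Q (n + 2)) * of_int (n + 1) * y n =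
    2 * charlier_gamma a (n + 1) * (of_int n + a - c) * h n
    - charlier_gamma a (n + 1) * charlier_gamma a n * lam * diff (Q n) * of_int (n - 1) * y (n - 2)"
proof -
  have n1: "0 \<le> n + 1" using assms by simp
  have zero:
    "r n n * charlier_inner a (Q n) (charlier a (n + 1)) = 0"
    "r n (n - 1) * charlier_inner a (Q (n - 1)) (charlier a (n + 1)) = 0"
    "r n (n - 2) * charlier_inner a (Q (n - 2)) (charlier a (n + 1)) = 0"
    by (rule lower_coeff_0[OF assms]; use assms in simp)+
  have "charlier_inner a (W * Q n) (charlier a (n + 1)) = charlier_inner a (Q (n + 2) + smult (r n (n + 1)) (Q (n + 1)) + smult (r n n) (Q n)
    + smult (r n (n - 1)) (Q (n - 1)) + smult (r n (n - 2)) (Q (n - 2))) (charlier a (n + 1))"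
    by (simp only: five_term[OF assms, symmetric])
  then show ?thesis
    using assms
    unfolding charlier_inner_W W_charlier[OF n1] I.bilinear zero
    by (simp add: Q_charlier_upper Q_charlier_diag Q_charlier_lower add.assoc algebra_simps)
qed

text \<open>Pairing with C_n instead keeps Q_{n+1} as well, so the coefficient above the diagonal
  enters.\<close>

lemma r_diag_raw:
  assumes "0 \<le> n"
  shows "r n n * h n - lam * diff (Q (n + 2)) * of_int n * y (n - 1)
      - r n (n + 1) * lam * diff (Q (n + 1)) * of_int n * y (n - 1) =
    (charlier_gamma a (n + 1) + (of_int n + a - c)\<^sup>2 + charlier_gamma a n - (of_int n + a - c)) * h n
    - 2 * charlier_gamma a n * (of_int n + a - c - 1) * lam * diff (Q n) * of_int (n - 1) * y (n - 2)
    - charlier_gamma a n * charlier_gamma a (n - 1) * lam * diff (Q n) * of_int (n - 2) * y (n - 3)"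
proof -
  have zero:
    "r n (n - 1) * charlier_inner a (Q (n - 1)) (charlier a n) = 0"
    "r n (n - 2) * charlier_inner a (Q (n - 2)) (charlier a n) = 0"
    by (rule lower_coeff_0[OF assms]; use assms in simp)+
  have "charlier_inner a (W * Q n) (charlier a n) = charlier_inner a (Q (n + 2) + smult (r n (n + 1)) (Q (n + 1)) + smult (r n n) (Q n)
    + smult (r n (n - 1)) (Q (n - 1)) + smult (r n (n - 2)) (Q (n - 2))) (charlier a n)"
    by (simp only: five_term[OF assms, symmetric])
  then show ?thesis
    using assms
    unfolding charlier_inner_W W_charlier[OF assms] I.bilinear zero
    by (simp add: Q_charlier_upper Q_charlier_diag Q_charlier_lower algebra_simps)
qed

section \<open>Closed forms of the coefficients and comparison with the rho\<close>

definition e :: "int \<Rightarrow> real" where "e n = lam / (h n * u (n - 1))"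

lemma b_e: "0 \<le> n \<Longrightarrow> b n = 1 + e n * (of_int n)\<^sup>2 * (y (n - 1))\<^sup>2"
  using u_pos[of "n - 1"] h_pos[of n] by (simp add: b_eq u_step e_def field_simps)

text \<open>Dividing by b_n advances the denominator from u_{n-1} to u_n; this links the forms
  obtained from sigma with those obtained from the recurrence.\<close>

lemma e_b: "e n / b n = lam / (h n * u n)"
  using u_pos[of n] u_pos[of "n - 1"] by (simp add: b_eq e_def)

lemma diff_Q_e: "0 \<le> n \<Longrightarrow> lam * diff (Q n) = h n * e n * of_int n * y (n - 1)"
  using diff_Q[of n] u_pos[of "n - 1"] h_pos[of n] by (simp add: e_def field_simps)

text \<open>One factor of the square C_{n-1}(c)^2 in b_n - 1 cancels the denominator;
  \<open>x / 0 = 0\<close> settles the zeros.\<close>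

lemma ratio_below: "0 \<le> n \<Longrightarrow>
    (b n - 1) / charlier_ratio a c (n - 2) = e n * (of_int n)\<^sup>2 * y (n - 1) * y (n - 2)"
  by (simp add: b_e charlier_ratio_def power2_eq_square)

lemma ratio_above: "0 \<le> n \<Longrightarrow>
    (b n - 1) * charlier_ratio a c (n - 1) = e n * (of_int n)\<^sup>2 * y (n - 1) * y n"
  by (simp add: b_e charlier_ratio_def power2_eq_square)

text \<open>The denominator-free form of gamma_{n-1} (b_n - 1) / a_{n-2}, a correction found in
  every coefficient but rho_{n,n-2}.\<close>

definition t :: "int \<Rightarrow> real" where
  "t n = a * of_int (n - 1) * (of_int n)\<^sup>2 * e n * y (n - 1) * y (n - 2)"

lemma gamma_ratio: "0 \<le> n \<Longrightarrow> charlier_gamma a (n - 1) / charlier_ratio a c (n - 2) * (b n - 1) = t n"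
proof -
  assume "0 \<le> n"
  have "charlier_gamma a (n - 1) / charlier_ratio a c (n - 2) * (b n - 1)
      = a * of_int (n - 1) * ((b n - 1) / charlier_ratio a c (n - 2))"
    by (simp add: charlier_gamma_def)
  then show ?thesis
    unfolding ratio_below[OF \<open>0 \<le> n\<close>] by (simp add: t_def mult_ac)
qed

lemma y_rec: "0 \<le> n \<Longrightarrow> y (n + 1) = (c - of_int n - a) * y n - of_int n * a * y (n - 1)"
  by (rule poly_charlier_rec)

lemma sigma_m1_eq:
  assumes "1 \<le> n"
  shows "sigma_m1 a lam c n = a * of_int n *
    (2 * b n * (of_int n + a - c - 1) + of_int n * of_int (n + 1) * e n * y (n - 1) * y n)"
proof -
  have n: "0 \<le> n" using assms by simp
  have "sigma_m1 a lam c n = a * of_int n * (of_int n + a - c - 1) * (b n + 1)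
      + a * ((b n - 1) * charlier_ratio a c (n - 1))
      - a * a * of_int n * of_int (n - 1) * ((b n - 1) / charlier_ratio a c (n - 2))"
    by (simp add: sigma_m1_def algebra_simps diff_divide_distrib)
  also have "\<dots> = a * of_int n * (of_int n + a - c - 1) * (b n + 1)
      + a * (e n * (of_int n)\<^sup>2 * y (n - 1) * y n)
      - a * of_int n * e n * (of_int n)\<^sup>2 * y (n - 1) * (of_int (n - 1) * a * y (n - 2))"
    unfolding ratio_above[OF n] ratio_below[OF n] by (simp add: mult_ac)
  \<comment> \<open>The recurrence at c eliminates C_{n-2}(c); the resulting C_{n-1}(c)^2 term
    merges with b_n + 1 into 2 b_n.\<close>
  also have "of_int (n - 1) * a * y (n - 2) = - (of_int n + a - c - 1) * y (n - 1) - y n"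
    using y_rec[of "n - 1"] assms by (simp add: algebra_simps)
  finally show ?thesis
    using assms by (simp add: b_e algebra_simps power2_eq_square)
qed

lemma sigma_m1_div:
  assumes "1 \<le> n"
  shows "sigma_m1 a lam c n / (a * of_int n * b n) = 2 * (of_int n + a - c - 1)
    + of_int n * of_int (n + 1) * y (n - 1) * y n * (e n / b n)"
proof -
  have "a * of_int n \<noteq> 0" "b n \<noteq> 0"
    using a assms b_pos[of n] by auto
  then show ?thesis
    unfolding sigma_m1_eq[OF assms] by (simp add: add_divide_distrib)
qed

text \<open>Solves \<open>r_up_raw\<close>; the norms cancel because gamma_{n+1} ||C_n||^2 =
  ||C_{n+1}||^2.\<close>

lemma r_up:
  assumes "0 \<le> n"
  shows "r n (n + 1) = 2 * (of_int n + a - c)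
    + of_int (n + 1) * of_int (n + 2) * y n * y (n + 1) * (lam / (h (n + 1) * u (n + 1))) - t n"
proof -
  have "diff (Q (n + 2)) = of_int (n + 2) * y (n + 1) / u (n + 1)"
    using diff_Q[of "n + 2"] u_pos[of "n + 1"] assms by (simp add: field_simps)
  then have "r n (n + 1) * h (n + 1) = lam * (of_int (n + 2) * y (n + 1) / u (n + 1)) * of_int (n + 1) * y n
      + 2 * (of_int n + a - c) * (charlier_gamma a (n + 1) * h n)
      - charlier_gamma a (n + 1) * charlier_gamma a n * (lam * diff (Q n)) * of_int (n - 1) * y (n - 2)"
    using r_up_raw[OF assms] by (simp add: algebra_simps)
  also have "charlier_gamma a (n + 1) * charlier_gamma a n * (lam * diff (Q n)) * of_int (n - 1) * y (n - 2)
      = (charlier_gamma a (n + 1) * h n) * t n"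
    using assms by (simp add: diff_Q_e t_def charlier_gamma_def power2_eq_square)
  also have "charlier_gamma a (n + 1) * h n = h (n + 1)"
    using assms by (simp add: h_Suc charlier_gamma_def)
  finally show ?thesis
    using h_pos[of "n + 1"] u_pos[of "n + 1"] assms by (simp add: field_simps)
qed

text \<open>By \<open>N_eq\<close> the norm quotient in rho is exactly the reciprocal of the divisor
  in \<open>sigma_m1_div\<close>.\<close>

lemma r_up_eq_rho:
  assumes "0 \<le> n"
  shows "r n (n + 1) = rho_p1 a lam c Q n"
proof -
  have "h n / N (n + 1) = 1 / (a * of_int (n + 1) * b (n + 1))"
    using h_pos[OF assms] assms a by (simp add: N_eq h_Suc)
  then have "sigma_m1 a lam c (n + 1) * h n / N (n + 1)
      = sigma_m1 a lam c (n + 1) / (a * of_int (n + 1) * b (n + 1))"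
    by (metis mult.right_neutral times_divide_eq_right)
  also have "\<dots> = 2 * (of_int n + a - c)
      + of_int (n + 1) * of_int (n + 2) * y n * y (n + 1) * (e (n + 1) / b (n + 1))"
    using sigma_m1_div[of "n + 1"] assms by (simp add: add.assoc)
  finally show ?thesis
    unfolding r_up[OF assms] rho_p1_def gamma_ratio[OF assms] e_b by simp
qed

text \<open>Solves \<open>r_diag_raw\<close>, after the two terms from above the diagonal are merged
  over the single denominator u_n.\<close>

lemma r_diag:
  assumes "1 \<le> n"
  shows "r n n = charlier_gamma a (n + 1) + (of_int n + a - c)\<^sup>2 + charlier_gamma a n - (of_int n + a - c)
    - 2 * (of_int n + a - c - 1) * t n
    - a * (of_int n)\<^sup>2 * e n * y (n - 1) * (of_int (n - 1) * a * of_int (n - 2) * y (n - 3))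
    + e n / b n * of_int n * y (n - 1) *
        (of_int (n + 2) * y (n + 1) + (2 * (of_int n + a - c) - t n) * of_int (n + 1) * y n)"
proof -
  have n: "0 \<le> n" using assms by simp
  define R where "R = 2 * (of_int n + a - c) - t n"
  have 1: "diff (Q (n + 1)) = of_int (n + 1) * y n / u n"
    using diff_Q[of "n + 1"] u_pos[of n] n by (simp add: field_simps)
  have 2: "diff (Q (n + 2)) = of_int (n + 2) * y (n + 1) / u (n + 1)"
    using diff_Q[of "n + 2"] u_pos[of "n + 1"] n by (simp add: field_simps)
  have R: "r n (n + 1) = R + of_int (n + 1) * of_int (n + 2) * y n * y (n + 1) * (lam / (h (n + 1) * u (n + 1)))"
    unfolding r_up[OF n] R_def by simp
  \<comment> \<open>The kernel increment u_{n+1} - u_n is what cancels u_{n+1} from the denominators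
    below.\<close>
  have u: "lam * (of_int (n + 1) * y n)\<^sup>2 / h (n + 1) = u (n + 1) - u n"
    using u_step[of "n + 1"] n by simp
  have "diff (Q (n + 2)) + r n (n + 1) * diff (Q (n + 1))
      = of_int (n + 2) * y (n + 1) / u (n + 1) + R * of_int (n + 1) * y n / u n
        + of_int (n + 2) * y (n + 1) / (u (n + 1) * u n) * (lam * (of_int (n + 1) * y n)\<^sup>2 / h (n + 1))"
    unfolding 1 2 R by (simp add: algebra_simps add_divide_distrib power2_eq_square del: of_int_add)
  also have "\<dots> = (of_int (n + 2) * y (n + 1) + R * of_int (n + 1) * y n) / u n"
    unfolding u using u_pos[of "n + 1"] u_pos[of n] by (simp add: field_simps)
  finally have up: "diff (Q (n + 2)) + r n (n + 1) * diff (Q (n + 1))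
    = (of_int (n + 2) * y (n + 1) + R * of_int (n + 1) * y n) / u n" .
  have "r n n * h n = (charlier_gamma a (n + 1) + (of_int n + a - c)\<^sup>2 + charlier_gamma a n - (of_int n + a - c)) * h n
    - 2 * charlier_gamma a n * (of_int n + a - c - 1) * (lam * diff (Q n)) * of_int (n - 1) * y (n - 2)
    - charlier_gamma a n * charlier_gamma a (n - 1) * (lam * diff (Q n)) * of_int (n - 2) * y (n - 3)
    + lam * of_int n * y (n - 1) * (diff (Q (n + 2)) + r n (n + 1) * diff (Q (n + 1)))"
    using r_diag_raw[OF n] by (simp add: algebra_simps)
  also have "\<dots> = h n * (charlier_gamma a (n + 1) + (of_int n + a - c)\<^sup>2 + charlier_gamma a n - (of_int n + a - c)
    - 2 * (of_int n + a - c - 1) * t n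
    - a * (of_int n)\<^sup>2 * e n * y (n - 1) * (of_int (n - 1) * a * of_int (n - 2) * y (n - 3))
    + lam / (h n * u n) * of_int n * y (n - 1) *
        (of_int (n + 2) * y (n + 1) + R * of_int (n + 1) * y n))"
    unfolding up diff_Q_e[OF n] t_def
    using h_pos[OF n] u_pos[of n]
    by (simp add: charlier_gamma_def field_simps power2_eq_square)
  finally show ?thesis
    using h_pos[OF n] unfolding e_b R_def by (simp del: times_divide_eq_left)
qed

text \<open>Multiplying by b_n > 0 clears the denominators; once the recurrence at c has eliminated
  the other Charlier values, both sides are polynomials in \<open>E\<close>, \<open>y1\<close>,
  \<open>y2\<close>, \<open>m\<close>, \<open>a\<close> and \<open>c\<close>.\<close>

lemma r_diag_eq_rho:
  assumes "1 \<le> n"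
  shows "r n n = rho_0 a lam c Q n"
proof -
  define B E y0 y1 y2 m where "B = b n" "E = e n" "y0 = y n" "y1 = y (n - 1)" "y2 = y (n - 2)" "m = real_of_int n"
  note defs = this
  have n: "0 \<le> n" using assms by simp
  have B: "B = 1 + E * m\<^sup>2 * y1\<^sup>2"
    unfolding defs by (rule b_e[OF n])
  have B_pos: "B > 0"
    unfolding defs by (rule b_pos)
  have t: "t n = a * (m - 1) * m\<^sup>2 * E * y1 * y2"
    by (simp add: t_def defs)
  have y0: "y0 = - (m + a - c - 1) * y1 - (m - 1) * a * y2"
    using y_rec[of "n - 1"] assms by (simp add: defs algebra_simps)
  have y: "y (n + 1) = - (m + a - c) * y0 - m * a * y1"
    using y_rec[OF n] by (simp add: defs algebra_simps)
  have y3: "(m - 1) * a * (m - 2) * y (n - 3) = (m - 1) * (- (m + a - c - 2) * y2 - y1)"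
  proof (cases "n = 1")
    case False
    then have "a * (m - 2) * y (n - 3) = - (m + a - c - 2) * y2 - y1"
      using y_rec[of "n - 2"] assms by (simp add: defs algebra_simps)
    then show ?thesis
      by (metis mult.assoc)
  qed (simp add: defs)
  have h: "h n / N n = 1 / B" "h (n - 1) / N n = 1 / (a * m * B)"
    using h_pos[OF n] h_pos[of "n - 1"] h_Suc[of "n - 1"] assms a by (simp_all add: N_eq defs)
  have "sigma0 a lam c n = a\<^sup>2 + (c - m) * (m - 2 * a + c + 1) + a * (m - 1) * (B - 1)
      + (m + a - c) * (2 * m - charlier_gamma a (n - 1) / charlier_ratio a c (n - 2) * (b n - 1))"
    by (simp add: sigma0_def defs charlier_gamma_def mult_ac)
  then have s0: "sigma0 a lam c n = a\<^sup>2 + (c - m) * (m - 2 * a + c + 1) + a * (m - 1) * (B - 1)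
      + (m + a - c) * (2 * m - t n)"
    unfolding gamma_ratio[OF n] .
  have s1: "sigma_m1 a lam c n / (a * m * B) = 2 * (m + a - c - 1) + m * (m + 1) * E * y1 * y0 / B"
    using sigma_m1_div[OF assms] by (simp add: defs)
  \<comment> \<open>Regroups the product so that \<open>gamma_ratio\<close> can replace it by
    \<open>t n\<close>.\<close>
  have distrib: "s - d * (q * z + g) = s - q * d * z - d * g" for s d q z g :: real
    by (simp add: algebra_simps)
  have "rho_0 a lam c Q n = sigma0 a lam c n * (h n / N n)
      - charlier_gamma a (n - 1) / charlier_ratio a c (n - 2) * (b n - 1)
        * (sigma_m1 a lam c n * (h (n - 1) / N n) - (m + a - c - 2)) - (B - 1) * (a - a * m)"
    unfolding rho_0_def distrib by (simp add: defs charlier_gamma_def mult.commute[of a])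
  also have "\<dots> = sigma0 a lam c n / B
      - t n * (sigma_m1 a lam c n / (a * m * B) - (m + a - c - 2)) - (B - 1) * (a - a * m)"
    unfolding gamma_ratio[OF n] h by simp
  finally have "B * rho_0 a lam c Q n = sigma0 a lam c n
      - t n * (B * (m + a - c) + m * (m + 1) * E * y1 * y0) - B * (B - 1) * (a - a * m)"
    unfolding s1 using B_pos by (simp add: field_simps)
  moreover have "r n n = a * (m + 1) + (m + a - c)\<^sup>2 + a * m - (m + a - c)
    - 2 * (m + a - c - 1) * t n - a * m\<^sup>2 * E * y1 * ((m - 1) * a * (m - 2) * y (n - 3))
    + E / B * m * y1 * ((m + 2) * y (n + 1) + (2 * (m + a - c) - t n) * (m + 1) * y0)"
    unfolding r_diag[OF assms] defs charlier_gamma_def by (simp add: mult.commute[of a])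
  then have "B * r n n = B * (a * (m + 1) + (m + a - c)\<^sup>2 + a * m - (m + a - c)
    - 2 * (m + a - c - 1) * t n - a * m\<^sup>2 * E * y1 * ((m - 1) * (- (m + a - c - 2) * y2 - y1)))
    + E * m * y1 * ((m + 2) * (- (m + a - c) * y0 - m * a * y1) + (2 * (m + a - c) - t n) * (m + 1) * y0)"
    unfolding y y3 using B_pos by (simp add: distrib_left[of B])
  ultimately have "B * r n n = B * rho_0 a lam c Q n"
    unfolding s0 t y0 B by (simp add: algebra_simps power2_eq_square)
  then show ?thesis
    using B_pos by simp
qed

text \<open>Symmetry of W yields this coefficient from the one above the diagonal at n - 1, hence
  the shifted indices in \<open>rho_m1\<close>.\<close>

lemma r_down_eq_rho:
  assumes "1 \<le> n"
  shows "r n (n - 1) = rho_m1 a lam c Q n"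
proof -
  have "r n (n - 1) = rho_p1 a lam c Q (n - 1) * N n / N (n - 1)"
    using r_swap[of n "n - 1"] r_up_eq_rho[of "n - 1"] N_pos[of "n - 1"] assms by (simp add: field_simps)
  then show ?thesis
    using N_pos[of n] assms by (simp add: rho_p1_def rho_m1_def left_diff_distrib diff_divide_distrib)
qed

text \<open>By symmetry the leading coefficient 1 at n - 2 becomes ||Q_n||^2 / ||Q_{n-2}||^2. For n
  = 1 both sides are 0, so the unconstrained \<open>Q (- 1)\<close> never contributes.\<close>

lemma r_down2_eq_rho:
  assumes "1 \<le> n"
  shows "r n (n - 2) = rho_m2 a lam c Q n"
proof (cases "n = 1")
  case False
  then have "r n (n - 2) = N n / N (n - 2)"
    using r_swap[of n "n - 2"] r_top[of "n - 2"] N_pos[of "n - 2"] assms by (simp add: field_simps)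
  moreover have "N n = a\<^sup>2 * of_int n * of_int (n - 1) * b n * h (n - 2)"
    using h_Suc[of "n - 1"] h_Suc[of "n - 2"] False assms by (simp add: N_eq power2_eq_square)
  ultimately show ?thesis
    by (simp add: rho_m2_def sigma_m2_def)
qed (simp add: r_def rho_m2_def sigma_m2_def)

end

theorem theorem5:
  fixes a lam c x :: real and n :: int and Q :: "int \<Rightarrow> real poly"
  assumes "a > 0"
    and "lam \<ge> 0"
    and "\<forall>k::nat. real k \<notin> {c<..<c + 1}"
    and "monic_orthogonal (sobolev_inner a lam c) Q"
    and "n \<ge> 1"
  shows "(x - c) * (x - c - 1) * poly (Q n) x =
           poly (Q (n + 2)) x
           + rho_p1 a lam c Q n * poly (Q (n + 1)) x
           + rho_0 a lam c Q n * poly (Q n) x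
           + rho_m1 a lam c Q n * poly (Q (n - 1)) x
           + rho_m2 a lam c Q n * poly (Q (n - 2)) x"
proof -
  interpret charlier_sobolev a lam c Q
    by unfold_locales fact+
  have "poly W x = (x - c) * (x - c - 1)"
    by (simp add: W_def algebra_simps)
  then show ?thesis
    using arg_cong[OF five_term[of n], of "\<lambda>p. poly p x"] assms(5)
    by (simp add: r_up_eq_rho r_diag_eq_rho r_down_eq_rho r_down2_eq_rho)
qed

end
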